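(* For each $N \in \{10^5, 10^6, 10^7, 10^8\}$ and all integers $a, b$ with $0 < a < N$ and $0 < b < N$, one has $a \sim b$; that is, there exist integers $i, j \ge 0$ with $h^{[i]}(a) = h^{[j]}(b)$.
   Context: For a positive integer $n$, $\tau(n)$ is the number of positive divisors of $n$, and $h(n) = n + \tau(n)$; $h^{[k]}$ denotes the $k$-th iterate of $h$ ($h^{[0]}$ is the identity). Write $a \sim b$ ("$a$ and $b$ coalesce") if there exist integers $i,j \ge 0$ with $h^{[i]}(a) = h^{[j]}(b)$. *)

theory Defs
  imports Main
begin

text \<open>For \<open>n = 0\<close> the set of divisors is infinite and \<open>tau 0 = 0\<close>;
  only positive arguments are meaningful.\<close>
definition tau :: "nat \<Rightarrow> nat" where
  "tau n = card {d. d dvd n}"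

definition h :: "nat \<Rightarrow> nat" where
  "h n = n + tau n"

definition coalesce :: "nat \<Rightarrow> nat \<Rightarrow> bool" (infix \<open>\<sim>\<close> 50) where
  "a \<sim> b \<longleftrightarrow> (\<exists>i j. (h ^^ i) a = (h ^^ j) b)"

end

theory Submission
  imports Defs "HOL-Computational_Algebra.Primes" "HOL-Library.Code_Binary_Nat"
begin

text \<open>
  Let \<open>m = 101263000\<close>. Iterating \<open>h\<close> moves every positive number upwards, and below \<open>m\<close> no step
  is longer than 847, because a number up to \<open>m\<close> has at most 847 divisors. So the orbit of every
  positive \<open>a < m\<close> visits one of the 847 numbers \<open>m, \<dots>, m + 846\<close> (\<open>enters_window\<close>), and all
  numbers below \<open>10 ^ 8\<close> coalesce as soon as these 847 do. This reduces a statement about \<open>10 ^ 8\<close>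
  orbits to a short stretch of integers. There it is a finite computation: all 847 orbits
  reach \<open>m + 1394\<close>.

  The position of \<open>m\<close> makes the computation short. Since \<open>tau n\<close> is odd only for squares, \<open>h\<close> preserves
  the parity of every non-square, and an orbit of even numbers can meet one of odd numbers only
  after one of them has hit a square. Around \<open>10 ^ 8\<close> squares are some 20000 apart and most orbits
  jump over most of them. Just above \<open>m\<close> lies \<open>10063 ^ 2 = m + 969\<close>; the odd orbits from the
  window have merged before it and hit it, so that from there on they are even, and soon afterwards
  they meet the even ones.

  Two facts about divisors carry the argument. The bound 847 comes from an estimate
  \<open>tau n ^ 4 \<le> C * n\<close> with the best possible constant, obtained one prime at a time from the
  multiplicativity of \<open>tau\<close> (\<open>tau_bound_all\<close>). The values of \<open>tau\<close> on the stretch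
  come from pairing \<open>d\<close> with \<open>n div d\<close> (\<open>tau_eq_twice_small_divisors\<close>), so that neither
  factorisations nor primality tests occur: it suffices to sieve the stretch by all
  \<open>d \<le> 10062\<close>, which produces about 14000 hits.
\<close>

section \<open>Coalescence\<close>

lemma coalesce_sym: "a \<sim> b \<Longrightarrow> b \<sim> a"
  unfolding coalesce_def by metis

lemma coalesce_trans:
  assumes "a \<sim> b" "b \<sim> c"
  shows "a \<sim> c"
proof -
  obtain i j k l where ij: "(h ^^ i) a = (h ^^ j) b" and kl: "(h ^^ k) b = (h ^^ l) c"
    using assms unfolding coalesce_def by blast
  have "(h ^^ (k + i)) a = (h ^^ (k + j)) b"
    using ij by (simp add: funpow_add)
  also have "\<dots> = (h ^^ (j + k)) b"
    by (simp add: add.commute)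
  also have "\<dots> = (h ^^ (j + l)) c"
    using kl by (simp add: funpow_add)
  finally show ?thesis
    unfolding coalesce_def by blast
qed

lemma coalesce_refl: "a \<sim> a"
  unfolding coalesce_def by blast

lemma coalesce_h: "a \<sim> h a"
  unfolding coalesce_def by (rule exI[of _ 1], rule exI[of _ 0]) simp

lemma tau_pos: "n > 0 \<Longrightarrow> tau n > 0"
  unfolding tau_def by (auto simp: card_gt_0_iff)

text \<open>Steps of length at most \<open>w\<close> cannot leap over \<open>w\<close> consecutive numbers.\<close>

lemma enters_window:
  assumes small: "\<And>n. 0 < n \<Longrightarrow> n < m \<Longrightarrow> tau n \<le> w"
    and "0 < a" "a < m"
  shows "\<exists>i<w. a \<sim> m + i"
  using \<open>0 < a\<close> \<open>a < m\<close>
proof (induction "m - a" arbitrary: a rule: less_induct)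
  case less
  show ?case
  proof (cases "h a < m")
    case True
    moreover have "a < h a"
      using tau_pos[of a] less.prems by (simp add: h_def)
    ultimately have "m - h a < m - a" "0 < h a"
      by auto
    from less.hyps[OF this \<open>h a < m\<close>] obtain i where "i < w" "h a \<sim> m + i"
      by blast
    then show ?thesis
      using coalesce_trans[OF coalesce_h] by blast
  next
    case False
    then have "h a = m + (h a - m)" "h a - m < w"
      using small[of a] less.prems by (auto simp: h_def)
    then show ?thesis
      using coalesce_h[of a] by metis
  qed
qed

section \<open>Bounding the number of divisors\<close>

lemma tau_prime_power_mult:
  assumes p: "prime p" and "\<not> p dvd m"
  shows "tau (p ^ a * m) = (a + 1) * tau m"
proof -
  let ?f = "\<lambda>(i, d). p ^ i * d :: nat"
  have mult: "multiplicity p (p ^ i * d) = i" if "d dvd m" for i d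
  proof -
    have "\<not> p dvd d"
      using that assms by (meson dvd_trans)
    then show ?thesis
      using p by (intro multiplicity_eqI) (auto simp: mult.commute)
  qed
  have "inj_on ?f ({..a} \<times> {d. d dvd m})"
  proof (rule inj_onI, clarsimp)
    fix i d j e
    assume "d dvd m" "e dvd m" and eq: "p ^ i * d = p ^ j * e"
    then have "i = j"
      using mult by metis
    then show "i = j \<and> d = e"
      using eq p by auto
  qed
  moreover have "?f ` ({..a} \<times> {d. d dvd m}) = {d. d dvd p ^ a * m}"
  proof (intro equalityI subsetI)
    fix x assume "x \<in> {d. d dvd p ^ a * m}"
    then obtain b c where "x = b * c" "b dvd p ^ a" "c dvd m"
      using division_decomp by blast
    moreover from this obtain i where "i \<le> a" "b = p ^ i"
      using divides_primepow_nat[OF p] by blast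
    ultimately show "x \<in> ?f ` ({..a} \<times> {d. d dvd m})"
      by force
  qed (auto intro!: mult_dvd_mono le_imp_power_dvd)
  ultimately have "card {d. d dvd p ^ a * m} = card ({..a} \<times> {d. d dvd m})"
    by (metis card_image)
  then show ?thesis
    by (simp add: tau_def card_cartesian_product)
qed

text \<open>A bound \<open>tau n ^ 4 \<le> (u / v) * n\<close>, cleared of denominators, for the \<open>n\<close> free of the primes in \<open>P\<close>.
Among all integer exponents \<open>e\<close> in bounds \<open>tau n ^ e \<le> C * n\<close>, the value 4 gives the sharpest bound near
\<open>10 ^ 8\<close>. Only the primes below \<open>2 ^ 4\<close> then need a constant of their own.\<close>

definition tau_bound :: "nat \<Rightarrow> nat \<Rightarrow> nat set \<Rightarrow> bool" where
  "tau_bound u v P \<longleftrightarrow> (\<forall>n>0. (\<forall>p\<in>P. \<not> p dvd n) \<longrightarrow> v * tau n ^ 4 \<le> u * n)"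

lemma split_prime:
  fixes n p :: nat
  assumes "prime p" "n > 0"
  obtains a m where "n = p ^ a * m" "\<not> p dvd m" "m > 0"
  by (metis assms multiplicity_decompose' not_prime_unit not_gr_zero dvd_0_right)

text \<open>By multiplicativity \<open>tau n ^ 4 / n\<close> is the product over the prime powers \<open>p ^ a\<close> in \<open>n\<close> of
\<open>(a + 1) ^ 4 / p ^ a\<close>. Admitting one more prime \<open>p\<close> therefore multiplies the constant by a
bound \<open>u' / v'\<close> for this factor.\<close>

lemma tau_bound_peel:
  assumes p: "prime p"
    and pow: "\<And>a. v' * (a + 1) ^ 4 \<le> u' * p ^ a"
    and bound: "tau_bound u v (insert p P)"
  shows "tau_bound (u * u') (v * v') P"
  unfolding tau_bound_def
proof (intro allI impI)
  fix n :: nat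
  assume "n > 0" and nP: "\<forall>q\<in>P. \<not> q dvd n"
  obtain a m where n: "n = p ^ a * m" "\<not> p dvd m" "m > 0"
    using split_prime[OF p \<open>n > 0\<close>] .
  have "\<forall>q\<in>insert p P. \<not> q dvd m"
    using n nP by auto
  then have "v * tau m ^ 4 \<le> u * m"
    using bound \<open>m > 0\<close> unfolding tau_bound_def by blast
  then have "(v' * (a + 1) ^ 4) * (v * tau m ^ 4) \<le> (u' * p ^ a) * (u * m)"
    by (rule mult_le_mono[OF pow])
  then show "v * v' * tau n ^ 4 \<le> u * u' * n"
    unfolding n(1) tau_prime_power_mult[OF p n(2)] power_mult_distrib
    by (simp only: mult_ac)
qed

text \<open>For primes \<open>p \<ge> 16\<close> the factor \<open>(a + 1) ^ 4 / p ^ a\<close> never exceeds 1, as \<open>a + 1 \<le> 2 ^ a\<close>.\<close>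

lemma tau_bound_rough: "tau_bound 1 1 {2, 3, 5, 7, 11, 13}"
proof -
  have "tau n ^ 4 \<le> n" if "n > 0" "\<forall>p\<in>{2, 3, 5, 7, 11, 13}. \<not> p dvd n" for n
    using that
  proof (induction n rule: less_induct)
    case (less n)
    show ?case
    proof (cases "n = 1")
      case True
      then show ?thesis
        by (simp add: tau_def)
    next
      case False
      then obtain p where p: "prime p" "p dvd n"
        using prime_factor_nat by blast
      have "p \<ge> 16"
      proof (rule ccontr)
        assume "\<not> p \<ge> 16"
        then have "p \<in> set [0..<16]"
          by simp
        then have "p \<in> {0,1,2,3,4,5,6,7,8,9,10,11,12,13,14,15}"
          by (simp add: upt_rec eval_nat_numeral)
        moreover have "\<not> q dvd p" if "q \<in> {2, 3, 5, 7, 11, 13}" for q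
          using less.prems(2) p(2) that dvd_trans by blast
        from this[of 2] this[of 3] this[of 5] this[of 7] this[of 11] this[of 13]
        have "\<not> 2 dvd p" "\<not> 3 dvd p" "\<not> 5 dvd p" "\<not> 7 dvd p" "\<not> 11 dvd p" "\<not> 13 dvd p"
          by blast+
        ultimately show False
          using p(1) by (elim insertE) simp_all
      qed
      obtain a m where n: "n = p ^ a * m" "\<not> p dvd m" "m > 0"
        using split_prime[OF p(1) less.prems(1)] .
      have "a > 0"
        using n p(2) by (cases a) auto
      then have "m < n"
        using n(1,3) one_less_power[of p a] \<open>p \<ge> 16\<close> by simp
      moreover have "\<forall>q\<in>{2, 3, 5, 7, 11, 13}. \<not> q dvd m"
        using less.prems(2) dvd_mult unfolding n(1) by blast
      ultimately have IH: "tau m ^ 4 \<le> m"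
        using less.IH \<open>m > 0\<close> by blast
      have "a + 1 \<le> 2 ^ a"
        by (induction a) auto
      then have "(a + 1) ^ 4 \<le> (2 ^ a) ^ 4"
        by (rule power_mono) auto
      also have "\<dots> = 16 ^ a"
        by (simp flip: power_mult add: mult.commute[of a 4]) (simp add: power_mult)
      also have "\<dots> \<le> p ^ a"
        using \<open>p \<ge> 16\<close> by (rule power_mono) auto
      finally have "(a + 1) ^ 4 * tau m ^ 4 \<le> p ^ a * m"
        using IH by (rule mult_le_mono)
      then show ?thesis
        unfolding n(1) tau_prime_power_mult[OF p(1) n(2)] power_mult_distrib .
    qed
  qed
  then show ?thesis
    by (simp add: tau_bound_def)
qed

text \<open>The quotient \<open>((a + 2) / (a + 1)) ^ 4\<close> decreases in \<open>a\<close>, so once it is at most \<open>p\<close> the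
factor \<open>(a + 1) ^ 4 / p ^ a\<close> can only decrease, and a finite check remains.\<close>

lemma power_dominates_fourth_power:
  fixes u v p a0 :: nat
  assumes start: "\<And>a. a \<le> a0 \<Longrightarrow> v * (a + 1) ^ 4 \<le> u * p ^ a"
    and ratio: "(a0 + 2) ^ 4 \<le> p * (a0 + 1) ^ 4"
  shows "v * (a + 1) ^ 4 \<le> u * p ^ a"
proof (cases "a \<le> a0")
  case False
  then have "a0 \<le> a"
    by simp
  then show ?thesis
  proof (induction a rule: dec_induct)
    case (step a)
    have "((a + 2) * (a0 + 1)) ^ 4 \<le> ((a0 + 2) * (a + 1)) ^ 4"
      using step by (intro power_mono) auto
    also have "\<dots> = (a0 + 2) ^ 4 * (a + 1) ^ 4"
      by (rule power_mult_distrib)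
    also have "\<dots> \<le> (p * (a0 + 1) ^ 4) * (a + 1) ^ 4"
      by (rule mult_right_mono[OF ratio]) simp
    finally have "(a0 + 1) ^ 4 * (a + 2) ^ 4 \<le> (a0 + 1) ^ 4 * (p * (a + 1) ^ 4)"
      by (simp only: power_mult_distrib mult_ac)
    then have "(a + 2) ^ 4 \<le> p * (a + 1) ^ 4"
      by (subst (asm) mult_le_cancel1) simp
    then have "v * (a + 2) ^ 4 \<le> p * (v * (a + 1) ^ 4)"
      by (metis mult.left_commute mult_le_mono2)
    also have "\<dots> \<le> p * (u * p ^ a)"
      using step.IH by (rule mult_le_mono2)
    finally show ?case
      by (simp add: mult_ac)
  qed (use start in auto)
qed (use start in auto)

text \<open>The maxima of \<open>(a + 1) ^ 4 / p ^ a\<close> are \<open>81/2\<close> (at \<open>a = 5\<close>), \<open>256/27\<close> (at \<open>a = 3\<close>), \<open>81/25\<close>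
(at \<open>a = 2\<close>), and \<open>16/p\<close> (at \<open>a = 1\<close>) for \<open>p = 7, 11, 13\<close>; the two numbers are the products of the
denominators and of the numerators.\<close>

lemma tau_bound_all: "1351350 * tau n ^ 4 \<le> 6879707136 * n" if "n > 0"
proof -
  have upto: "a \<le> 5 \<Longrightarrow> a \<in> {0, 1, 2, 3, 4, 5}" "a \<le> 2 \<Longrightarrow> a \<in> {0, 1, 2}"
       "a \<le> 3 \<Longrightarrow> a \<in> {0, 1, 2, 3}" for a :: nat
    by auto
  have 2: "2 * (a + 1) ^ 4 \<le> 81 * 2 ^ a" for a :: nat
    by (rule power_dominates_fourth_power[where ?a0.0 = 5]) (auto dest!: upto simp del: One_nat_def)
  have 3: "27 * (a + 1) ^ 4 \<le> 256 * 3 ^ a" for a :: nat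
    by (rule power_dominates_fourth_power[where ?a0.0 = 3]) (auto dest!: upto simp del: One_nat_def)
  have 5: "25 * (a + 1) ^ 4 \<le> 81 * 5 ^ a" for a :: nat
    by (rule power_dominates_fourth_power[where ?a0.0 = 2]) (auto dest!: upto simp del: One_nat_def)
  have 7: "7 * (a + 1) ^ 4 \<le> 16 * 7 ^ a" for a :: nat
    by (rule power_dominates_fourth_power[where ?a0.0 = 2]) (auto dest!: upto simp del: One_nat_def)
  have 11: "11 * (a + 1) ^ 4 \<le> 16 * 11 ^ a" for a :: nat
    by (rule power_dominates_fourth_power[where ?a0.0 = 2]) (auto dest!: upto simp del: One_nat_def)
  have 13: "13 * (a + 1) ^ 4 \<le> 16 * 13 ^ a" for a :: nat
    by (rule power_dominates_fourth_power[where ?a0.0 = 2]) (auto dest!: upto simp del: One_nat_def)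
  have primes: "prime (2::nat)" "prime (3::nat)" "prime (5::nat)" "prime (7::nat)"
    "prime (11::nat)" "prime (13::nat)"
    by simp_all
  note tau_bound_peel[OF primes(1) 2 tau_bound_rough]
  note tau_bound_peel[OF primes(2) 3 this]
  note tau_bound_peel[OF primes(3) 5 this]
  note tau_bound_peel[OF primes(4) 7 this]
  note tau_bound_peel[OF primes(5) 11 this]
  note tau_bound_peel[OF primes(6) 13 this]
  then show ?thesis
    using that by (simp add: tau_bound_def)
qed

section \<open>Divisors in pairs\<close>

text \<open>The map \<open>d \<mapsto> n div d\<close> sends the divisors up to \<open>b\<close>, about the square root of \<open>n\<close>, to larger
ones, and only \<open>b + 1\<close> can be missed. The range of \<open>n\<close> is chosen so that one \<open>b\<close> serves numbers
on both sides of the square \<open>(b + 1) ^ 2\<close>: two cofactors above \<open>b\<close> must both be \<open>b + 1\<close>, since otherwise their product is at least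
\<open>(b + 1) * (b + 2)\<close>.\<close>

lemma tau_eq_twice_small_divisors:
  fixes b n :: nat
  assumes low: "b ^ 2 < n" and high: "n < (b + 1) * (b + 2)"
  shows "tau n = 2 * card {d \<in> {1..b}. d dvd n} + (if n = (b + 1) ^ 2 then 1 else 0)"
proof -
  let ?S = "{d \<in> {1..b}. d dvd n}" and ?Q = "if n = (b + 1) ^ 2 then {b + 1} else {}"
  have "n > 0"
    using low by simp
  have big: "n div d > b" if "d \<in> ?S" for d
  proof (rule ccontr)
    assume "\<not> n div d > b"
    then have "d * (n div d) \<le> b * b"
      using that by (intro mult_le_mono) auto
    then show False
      using that low by (simp add: power2_eq_square)
  qed
  have inj: "inj_on (\<lambda>d. n div d) ?S"
  proof (rule inj_onI)
    fix d e assume de: "d \<in> ?S" "e \<in> ?S" "n div d = n div e"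
    then have "d * (n div d) = e * (n div d)"
      by auto
    then show "d = e"
      using big[OF de(1)] by simp
  qed
  have divisors: "{d. d dvd n} = ?S \<union> (\<lambda>d. n div d) ` ?S \<union> ?Q"
  proof (intro equalityI subsetI)
    fix d assume "d \<in> {d. d dvd n}"
    then obtain e where n: "n = d * e"
      by auto
    with \<open>n > 0\<close> have "d > 0" "e > 0"
      by auto
    consider "d \<le> b" | "e \<le> b" | "d > b" "e > b"
      by linarith
    then show "d \<in> ?S \<union> (\<lambda>d. n div d) ` ?S \<union> ?Q"
    proof cases
      case 1
      then show ?thesis
        using n \<open>d > 0\<close> by auto
    next
      case 2
      then have "e \<in> ?S" "d = n div e"
        using n \<open>e > 0\<close> by auto
      then have "d \<in> (\<lambda>d. n div d) ` ?S"
        by (rule rev_image_eqI)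
      then show ?thesis
        by blast
    next
      case 3
      have "\<not> (d \<ge> b + 2 \<or> e \<ge> b + 2)"
      proof
        assume "d \<ge> b + 2 \<or> e \<ge> b + 2"
        then have "(b + 1) * (b + 2) \<le> d * e"
        proof
          assume "d \<ge> b + 2"
          then have "(b + 2) * (b + 1) \<le> d * e"
            using 3 by (intro mult_le_mono) simp_all
          then show ?thesis
            by (subst mult.commute)
        next
          assume "e \<ge> b + 2"
          then show ?thesis
            using 3 by (intro mult_le_mono) simp_all
        qed
        then show False
          using high n by simp
      qed
      with 3 have "d = b + 1" "e = b + 1"
        by auto
      then show ?thesis
        using n by (simp add: power2_eq_square)
    qed
  next
    fix d assume "d \<in> ?S \<union> (\<lambda>d. n div d) ` ?S \<union> ?Q"
    then consider "d \<in> ?S" | e where "e \<in> ?S" "d = n div e" | "d \<in> ?Q"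
      by blast
    then show "d \<in> {d. d dvd n}"
    proof cases
      case 2
      then have "n = e * d"
        by simp
      then show ?thesis
        by simp
    qed (auto split: if_splits)
  qed
  have card1: "card (?S \<union> (\<lambda>d. n div d) ` ?S) = card ?S + card ((\<lambda>d. n div d) ` ?S)"
    using big by (intro card_Un_disjoint) fastforce+
  have card2: "card (?S \<union> (\<lambda>d. n div d) ` ?S \<union> ?Q) = card (?S \<union> (\<lambda>d. n div d) ` ?S) + card ?Q"
  proof (intro card_Un_disjoint)
    have root: "b + 1 \<notin> ?S \<union> (\<lambda>d. n div d) ` ?S" if "n = (b + 1) ^ 2"
    proof
      assume "b + 1 \<in> ?S \<union> (\<lambda>d. n div d) ` ?S"
      then obtain d where d: "d \<in> ?S" "n div d = b + 1"
        by force
      have "d * (n div d) = (b + 1) * (b + 1)"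
        using d(1) that by (simp add: power2_eq_square)
      then have "d = b + 1"
        unfolding d(2) by (subst (asm) mult_cancel2) simp
      then show False
        using d(1) by simp
    qed
    have disjoint: "(c \<Longrightarrow> x \<notin> A) \<Longrightarrow> A \<inter> (if c then {x} else {}) = {}" for A :: "nat set" and c x
      by (cases c) auto
    show "(?S \<union> (\<lambda>d. n div d) ` ?S) \<inter> ?Q = {}"
      by (rule disjoint) (rule root)
  qed auto
  have "card ?Q = (if n = (b + 1) ^ 2 then 1 else 0)"
    by simp
  then show ?thesis
    unfolding tau_def divisors card2 card1 card_image[OF inj] by linarith
qed

section \<open>Sieving the window\<close>

text \<open>
  Numbers in the window are represented by their offsets from its left end \<open>m\<close>. The functions of
  this and the next section are evaluated by rewriting, with numbers in binary. Rewriting an \<open>if\<close> or a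
  \<open>let\<close> whose branches contain long lists traverses these lists again at every step; therefore the
  functions on long lists branch by pattern matching on a boolean argument, and shared values
  are passed as arguments to auxiliary functions.
\<close>

function multiples_below :: "nat \<Rightarrow> nat \<Rightarrow> nat \<Rightarrow> nat list" where
  "multiples_below r d s = (if d = 0 \<or> r \<le> s then [] else s # multiples_below r d (s + d))"
  by auto
termination by (relation "measure (\<lambda>(r, d, s). r - s)") auto

declare multiples_below.simps [simp del]

text \<open>If \<open>m + s = k * d\<close> with \<open>s < d\<close>, then \<open>s\<close> is the offset of the first multiple of \<open>d\<close> in the
window. As \<open>m + (s + k) = k * (d + 1)\<close>, the first multiple of \<open>d + 1\<close> is found by removing the
multiples of \<open>d + 1\<close> from \<open>s + k\<close>. For large \<open>d\<close> the quotient \<open>c\<close> has only a few bits, which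
makes this division far cheaper than reducing \<open>m\<close> modulo \<open>d + 1\<close>.\<close>

fun renormalise :: "nat \<Rightarrow> nat \<Rightarrow> nat \<Rightarrow> nat \<Rightarrow> nat \<times> nat" where
  "renormalise k s d c = (k - c, k + s - c * d)"

fun sieve :: "nat \<Rightarrow> nat \<times> nat \<Rightarrow> nat list \<Rightarrow> nat list" where
  "sieve r ks [] = []"
| "sieve r (k, s) (d # ds) =
     multiples_below r d s @ sieve r (renormalise k s (d + 1) ((k + s) div (d + 1))) ds"

lemma count_multiples_below:
  assumes "d > 0"
  shows "count_list (multiples_below r d s) x = (if s \<le> x \<and> x < r \<and> d dvd x - s then 1 else 0)"
  using assms
proof (induction r d s rule: multiples_below.induct)
  case (1 r d s)
  show ?case
  proof (cases "r \<le> s")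
    case True
    then show ?thesis
      by (simp add: multiples_below.simps[of r d s])
  next
    case False
    have step: "count_list (multiples_below r d s) x =
        (if x = s then 1 else 0) + (if s + d \<le> x \<and> x < r \<and> d dvd x - (s + d) then 1 else 0)"
      using 1 False by (auto simp: multiples_below.simps[of r d s])
    show ?thesis
    proof (cases "x = s")
      case True
      then show ?thesis
        using step False \<open>d > 0\<close> by simp
    next
      case neq: False
      have "(s + d \<le> x \<and> d dvd x - (s + d)) \<longleftrightarrow> (s \<le> x \<and> d dvd x - s)"
      proof (cases "s + d \<le> x")
        case True
        then have "x - s = (x - (s + d)) + d"
          by simp
        then show ?thesis
          using True by (metis add_leD1 dvd_add_triv_right_iff)
      next
        case False
        then have "\<not> d dvd x - s" if "s \<le> x"
          using neq that by (intro nat_dvd_not_less) auto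
        then show ?thesis
          using False by auto
      qed
      then show ?thesis
        using step neq by auto
    qed
  qed
qed

text \<open>In the list of all hits, an offset occurs once for every divisor.\<close>

lemma count_sieve:
  assumes "0 < d" "m + s = k * d" "s < d" "x < r"
  shows "count_list (sieve r (k, s) [d..<e]) x = length (filter (\<lambda>d. d dvd m + x) [d..<e])"
  using assms
proof (induction "e - d" arbitrary: d k s)
  case (Suc n)
  have "s \<le> x \<and> d dvd x - s \<longleftrightarrow> d dvd m + x"
  proof (cases "s \<le> x")
    case True
    then have "m + x = k * d + (x - s)"
      using Suc.prems(2) by simp
    moreover have "d dvd k * d + (x - s) \<longleftrightarrow> d dvd x - s"
      by (rule dvd_add_right_iff) simp
    ultimately show ?thesis
      using True by (simp only: simp_thms)
  next
    case False
    have "\<not> d dvd m + x"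
    proof
      assume "d dvd m + x"
      then have "d dvd (m + s) - (m + x)"
        using Suc.prems(2) by (intro dvd_diff_nat) auto
      then show False
        using False Suc.prems(3) by (auto dest: dvd_imp_le)
    qed
    then show ?thesis
      using False by simp
  qed
  then have head: "count_list (multiples_below r d s) x = (if d dvd m + x then 1 else 0)"
    using Suc.prems(1,4) by (auto simp: count_multiples_below)
  define c where "c = (k + s) div (d + 1)"
  have "k + s = c * (d + 1) + (k + s) mod (d + 1)"
    unfolding c_def by (rule div_mult_mod_eq[symmetric])
  moreover have "(k + s) mod (d + 1) < d + 1"
    by simp
  ultimately have s': "k + s - c * (d + 1) < d + 1" "c * (d + 1) \<le> k + s"
    by linarith+
  have "c \<le> k"
  proof (rule ccontr)
    assume "\<not> c \<le> k"
    then have "(k + 1) * (d + 1) \<le> c * (d + 1)"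
      by (intro mult_le_mono) auto
    then show False
      using s'(2) Suc.prems(3) by (simp add: algebra_simps)
  qed
  then have "(k - c) * (d + 1) = k * d + k - c * (d + 1)"
    by (simp add: diff_mult_distrib)
  then have inv: "m + (k + s - c * (d + 1)) = (k - c) * (d + 1)"
    using Suc.prems(2) s'(2) by linarith
  have "count_list (sieve r (k - c, k + s - c * (d + 1)) [d + 1..<e]) x
      = length (filter (\<lambda>d. d dvd m + x) [d + 1..<e])"
    using Suc.hyps(2) Suc.prems(4) s'(1) inv by (intro Suc.hyps(1)) auto
  moreover have "[d..<e] = d # [d + 1..<e]"
    using Suc.hyps(2) by (simp add: upt_conv_Cons)
  ultimately show ?case
    by (simp add: head c_def del: upt_Suc)
qed simp

text \<open>The time for a rewriting step grows with the length of the lists in the rewritten term, so the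
hits are kept in blocks, one for each interval between consecutive boundaries \<open>d\<close> and \<open>e\<close>. An interval
\<open>[d, 2 * d)\<close> yields about \<open>ln 2 * r\<close> hits, whatever \<open>d\<close> is.\<close>

fun first_multiple :: "nat \<Rightarrow> nat \<Rightarrow> nat \<Rightarrow> nat \<times> nat" where
  "first_multiple m d k = (k, k * d - m)"

fun sieve_blocks :: "nat \<Rightarrow> nat \<Rightarrow> nat \<Rightarrow> nat list \<Rightarrow> nat list list" where
  "sieve_blocks m r d [] = []"
| "sieve_blocks m r d (e # es) =
     sieve r (first_multiple m d ((m + d - 1) div d)) [d..<e] # sieve_blocks m r e es"

lemma count_sieve_blocks:
  assumes "0 < d" "0 < m" "x < r" "sorted (d # es)"
  shows "count_list (concat (sieve_blocks m r d es)) x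
    = length (filter (\<lambda>d. d dvd m + x) [d..<last (d # es)])"
  using assms(1,4)
proof (induction es arbitrary: d)
  case (Cons e es)
  define k where "k = (m + d - 1) div d"
  have "m + d - 1 = k * d + (m + d - 1) mod d"
    unfolding k_def by (rule div_mult_mod_eq[symmetric])
  moreover have "(m + d - 1) mod d < d"
    using Cons.prems(1) by simp
  ultimately have "m \<le> k * d" "k * d - m < d"
    using \<open>0 < m\<close> by linarith+
  then have "count_list (sieve r (k, k * d - m) [d..<e]) x = length (filter (\<lambda>d. d dvd m + x) [d..<e])"
    using Cons.prems(1) \<open>x < r\<close> by (intro count_sieve) auto
  moreover have "count_list (concat (sieve_blocks m r e es)) x
      = length (filter (\<lambda>d. d dvd m + x) [e..<last (e # es)])"
    using Cons.prems by (intro Cons.IH) auto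
  moreover have "[d..<last (d # e # es)] = [d..<e] @ [e..<last (e # es)]"
  proof -
    have "last (e # es) \<in> set (e # es)"
      by (rule last_in_set) simp
    then have "d \<le> e" "e \<le> last (e # es)"
      using Cons.prems(2) by auto
    then show ?thesis
      using upt_add_eq_append[of d e "last (e # es) - e"] by simp
  qed
  ultimately show ?case
    by (simp add: k_def)
qed simp

lemma sieve_below: "x \<in> set (sieve r ks ds) \<Longrightarrow> x < r"
proof (induction r ks ds rule: sieve.induct)
  case (2 r k s d ds)
  have "x \<in> set (multiples_below r d s) \<Longrightarrow> x < r"
    by (induction r d s rule: multiples_below.induct)
      (subst (asm) multiples_below.simps, auto split: if_splits)
  then show ?case
    using 2 by auto
qed simp

lemma sieve_blocks_below: "xs \<in> set (sieve_blocks m r d es) \<Longrightarrow> x \<in> set xs \<Longrightarrow> x < r"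
  by (induction es arbitrary: d) (auto dest: sieve_below)

text \<open>A radix sort distributes the hits to their offsets: \<open>2 ^ k\<close> buckets are filled by splitting
according to the binary digits, the leading one first. Only the lengths of the buckets matter; they
serve as unary counters.\<close>

fun prepend_if :: "bool \<Rightarrow> nat \<Rightarrow> nat list \<Rightarrow> nat list" where
  "prepend_if True x ys = x # ys"
| "prepend_if False x ys = ys"

fun lower_half :: "nat \<Rightarrow> nat list \<Rightarrow> nat list" where
  "lower_half p [] = []"
| "lower_half p (x # xs) = prepend_if (x < p) x (lower_half p xs)"

fun upper_half :: "nat \<Rightarrow> nat list \<Rightarrow> nat list" where
  "upper_half p [] = []"
| "upper_half p (x # xs) = prepend_if (p \<le> x) (x - p) (upper_half p xs)"

fun halvings :: "nat \<Rightarrow> nat list" where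
  "halvings 0 = []"
| "halvings (Suc k) = 2 ^ k # halvings k"

fun buckets :: "nat list \<Rightarrow> nat list list \<Rightarrow> nat list list" where
  "buckets [] xss = [concat xss]"
| "buckets (p # ps) xss = buckets ps (map (lower_half p) xss) @ buckets ps (map (upper_half p) xss)"

lemma length_buckets: "length (buckets (halvings k) xss) = 2 ^ k"
  by (induction k arbitrary: xss) auto

lemma lower_half_eq_filter: "lower_half p xs = filter (\<lambda>x. x < p) xs"
  by (induction xs) auto

lemma upper_half_eq_filter: "upper_half p xs = map (\<lambda>x. x - p) (filter (\<lambda>x. p \<le> x) xs)"
  by (induction xs) auto

lemma count_lower_half:
  "x < p \<Longrightarrow> count_list (concat (map (lower_half p) xss)) x = count_list (concat xss) x"
proof (induction xss)
  case (Cons xs xss)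
  have "count_list (lower_half p xs) x = count_list xs x"
    unfolding lower_half_eq_filter using Cons.prems by (induction xs) auto
  then show ?case
    using Cons by simp
qed simp

lemma count_upper_half:
  "p \<le> x \<Longrightarrow> count_list (concat (map (upper_half p) xss)) (x - p) = count_list (concat xss) x"
proof (induction xss)
  case (Cons xs xss)
  have "count_list (upper_half p xs) (x - p) = count_list xs x"
    unfolding upper_half_eq_filter using Cons.prems by (induction xs) auto
  then show ?case
    using Cons by simp
qed simp

lemma length_nth_buckets:
  assumes "\<forall>xs\<in>set xss. \<forall>y\<in>set xs. y < 2 ^ k" "x < 2 ^ k"
  shows "length (buckets (halvings k) xss ! x) = count_list (concat xss) x"
  using assms
proof (induction k arbitrary: xss x)
  case 0
  have "count_list ys 0 = length ys" if "\<forall>y\<in>set ys. y = 0" for ys :: "nat list"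
    using that by (induction ys) auto
  then have "count_list (concat xss) 0 = length (concat xss)"
    using 0 by simp
  then show ?case
    using 0 by simp
next
  case (Suc k)
  have "\<forall>xs\<in>set (map (lower_half (2 ^ k)) xss). \<forall>y\<in>set xs. y < 2 ^ k"
    "\<forall>xs\<in>set (map (upper_half (2 ^ k)) xss). \<forall>y\<in>set xs. y < 2 ^ k"
    using Suc.prems(1)
    by (auto simp: lower_half_eq_filter upper_half_eq_filter less_diff_conv2 simp flip: mult_2)
  then show ?case
    using Suc by (simp add: nth_append length_buckets count_lower_half count_upper_half)
qed

section \<open>Following the orbits through the window\<close>

text \<open>
  Whether the orbit of \<open>m + x\<close> reaches the right end of the window is decided for decreasing \<open>x\<close>:
  the flag of \<open>x\<close> is the flag of \<open>x + tau (m + x)\<close>, which is further along in the list of flags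
  found so far. With \<open>tau (m + x)\<close> twice the length of the bucket of \<open>x\<close>, this flag is reached
  by dropping two flags for each entry of the bucket.
\<close>

fun flag_at_double :: "nat list \<Rightarrow> bool list \<Rightarrow> bool" where
  "flag_at_double [] (f # fs) = f"
| "flag_at_double (_ # b) (_ # _ # fs) = flag_at_double b fs"
| "flag_at_double _ _ = False"

text \<open>In front of the known flags, which start at offset \<open>x + 1\<close>, a dummy entry stands for \<open>x\<close> itself.
At a square \<open>tau\<close> is odd, and the missing unit is supplied by leaving the dummy out.\<close>

fun add_flag :: "bool \<Rightarrow> nat list \<Rightarrow> bool list \<Rightarrow> bool list" where
  "add_flag True b fs = flag_at_double b fs # fs"
| "add_flag False b fs = flag_at_double b (False # fs) # fs"

fun reach_flags :: "nat \<Rightarrow> nat list \<Rightarrow> nat list list \<Rightarrow> bool list" where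
  "reach_flags q (x # xs) (b # bs) = add_flag (x = q) b (reach_flags q xs bs)"
| "reach_flags q _ _ = [True]"

fun all_true_along :: "nat list \<Rightarrow> bool list \<Rightarrow> bool" where
  "all_true_along [] fs = True"
| "all_true_along (_ # xs) (f # fs) = (f \<and> all_true_along xs fs)"
| "all_true_along _ _ = False"

text \<open>Here \<open>b + 1\<close> is the root of the square inside the window, offsets have \<open>k\<close> binary digits, and
\<open>1 # es\<close> are the block boundaries. The first \<open>w\<close> of the \<open>r\<close> offsets are the places where an orbit may
enter.\<close>

definition window_merges :: "nat \<Rightarrow> nat \<Rightarrow> nat \<Rightarrow> nat \<Rightarrow> nat \<Rightarrow> nat list \<Rightarrow> bool" where
  "window_merges m w r k b es \<longleftrightarrow> all_true_along [0..<w]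
     (reach_flags ((b + 1) ^ 2 - m) [0..<r] (buckets (halvings k) (sieve_blocks m r 1 es)))"

lemma flag_at_doubleD: "flag_at_double b fs \<Longrightarrow> 2 * length b < length fs \<and> fs ! (2 * length b)"
  by (induction b fs rule: flag_at_double.induct) auto

lemma all_true_alongD: "all_true_along xs fs \<Longrightarrow> i < length xs \<Longrightarrow> i < length fs \<and> fs ! i"
proof (induction xs fs arbitrary: i rule: all_true_along.induct)
  case (2 x xs f fs)
  then show ?case
    by (cases i) auto
qed auto

text \<open>Only true flags are conclusive: an orbit that leaps over the right end gets a false flag even if it
meets the others later.\<close>

lemma reach_flags_sound:
  assumes "length xs \<le> length bs"
    and "\<And>i. i < length xs \<Longrightarrow> tau (m + i) = 2 * length (bs ! i) + (if xs ! i = q then 1 else 0)"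
    and "i < length (reach_flags q xs bs)" "reach_flags q xs bs ! i"
  shows "m + i \<sim> m + length xs"
  using assms
proof (induction q xs bs arbitrary: m i rule: reach_flags.induct)
  case (1 q x xs b bs)
  let ?fs = "reach_flags q xs bs"
  have tau_m: "tau m = 2 * length b + (if x = q then 1 else 0)"
    using "1.prems"(2)[of 0] by simp
  have tau_Suc: "tau (Suc m + j) = 2 * length (bs ! j) + (if xs ! j = q then 1 else 0)"
    if "j < length xs" for j
    using "1.prems"(2)[of "Suc j"] that by simp
  have IH: "Suc m + j \<sim> m + length (x # xs)" if "j < length ?fs" "?fs ! j" for j
    using "1.IH"[of "Suc m" j] "1.prems"(1) tau_Suc that by simp
  show ?case
  proof (cases i)
    case 0
    have "\<exists>j < length ?fs. ?fs ! j \<and> Suc j = tau m"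
    proof (cases "x = q")
      case True
      then have "flag_at_double b ?fs"
        using "1.prems"(4) 0 by simp
      then show ?thesis
        using flag_at_doubleD tau_m True by auto
    next
      case False
      then have "flag_at_double b (False # ?fs)"
        using "1.prems"(4) 0 by simp
      then have j: "2 * length b < Suc (length ?fs)" "(False # ?fs) ! (2 * length b)"
        using flag_at_doubleD by fastforce+
      (* The dummy is False, so a true flag was found beyond it. *)
      then have "2 * length b \<noteq> 0"
        by (cases b) auto
      then obtain k where "2 * length b = Suc k"
        using not0_implies_Suc by blast
      then show ?thesis
        using j tau_m False by auto
    qed
    then obtain j where j: "j < length ?fs" "?fs ! j" and "Suc j = tau m"
      by blast
    then have "h m = Suc m + j"
      by (simp add: h_def)
    then have "h m \<sim> m + length (x # xs)"
      using IH[OF j] by simp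
    then show ?thesis
      using coalesce_trans[OF coalesce_h] 0 by simp
  next
    case (Suc j)
    then show ?thesis
      using IH[of j] "1.prems"(3,4) by (cases "x = q") auto
  qed
qed (auto simp: coalesce_refl)

lemma window_merges_sound:
  assumes merges: "window_merges m w r k b es"
    and "sorted (1 # es)" "last (1 # es) = b + 1"
    and "r \<le> 2 ^ k" "b ^ 2 < m" "m \<le> (b + 1) ^ 2" "m + r \<le> (b + 1) * (b + 2)" "i < w"
  shows "m + i \<sim> m + r"
proof -
  define bs where "bs = buckets (halvings k) (sieve_blocks m r 1 es)"
  define q where "q = (b + 1) ^ 2 - m"
  have len: "length (bs ! x) = card {d \<in> {1..b}. d dvd m + x}" if "x < r" for x
  proof -
    have "length (bs ! x) = count_list (concat (sieve_blocks m r 1 es)) x"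
      unfolding bs_def using that assms(4) sieve_blocks_below by (intro length_nth_buckets) fastforce+
    also have "\<dots> = length (filter (\<lambda>d. d dvd m + x) [1..<b + 1])"
      using count_sieve_blocks[of 1 m x r es] assms(2,3,5) that by simp
    also have "\<dots> = card (set (filter (\<lambda>d. d dvd m + x) [1..<b + 1]))"
      by (rule distinct_card[symmetric]) simp
    also have "set (filter (\<lambda>d. d dvd m + x) [1..<b + 1]) = {d \<in> {1..b}. d dvd m + x}"
      by auto
    finally show ?thesis .
  qed
  have tau: "tau (m + x) = 2 * length (bs ! x) + (if [0..<r] ! x = q then 1 else 0)" if "x < r" for x
  proof -
    have "m + x = (b + 1) ^ 2 \<longleftrightarrow> x = q"
      using assms(6) by (auto simp: q_def)
    moreover have "b ^ 2 < m + x" "m + x < (b + 1) * (b + 2)"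
      using assms(5,7) that by auto
    ultimately show ?thesis
      using tau_eq_twice_small_divisors[of b "m + x"] len[OF that] that by simp
  qed
  have "i < length (reach_flags q [0..<r] bs) \<and> reach_flags q [0..<r] bs ! i"
    using merges \<open>i < w\<close> unfolding window_merges_def bs_def q_def
    by (intro all_true_alongD) auto
  then show ?thesis
    using reach_flags_sound[of "[0..<r]" bs m q i] tau assms(4)
    by (auto simp: bs_def length_buckets)
qed

section \<open>The orbits below \<open>10 ^ 8\<close>\<close>

text \<open>Offset \<open>1394 < 2 ^ 11\<close> is where all orbits have met, and \<open>10062 + 1 = 10063\<close> is the root of
the square in the window. The block boundaries are powers of 2, with further ones inserted where a
block would consist of too many divisors.\<close>

lemma window_at_101263000: "window_merges 101263000 847 1394 11 10062
  [2, 4, 8, 16, 32, 64, 128, 256, 512, 1024, 2048, 3072, 4096, 5120, 6144, 7168, 8192, 9216, 10063]"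
  by code_simp

theorem theorem4p1:
  fixes N a b :: nat
  assumes "N \<in> {10^5, 10^6, 10^7, 10^8}"
    and "0 < a" "a < N"
    and "0 < b" "b < N"
  shows "a \<sim> b"
proof -
  (* 1351350 * 848 ^ 4 exceeds 6879707136 * 101263000. *)
  have tau_small: "tau n \<le> 847" if "0 < n" "n < 101263000" for n
  proof (rule ccontr)
    assume "\<not> tau n \<le> 847"
    then have "848 ^ 4 \<le> tau n ^ 4"
      by (intro power_mono) auto
    then show False
      using tau_bound_all[of n] that by simp
  qed
  have "c \<sim> 101263000 + 1394" if "0 < c" "c < N" for c
  proof -
    have "N \<le> 100000000"
      using assms(1) by auto
    with that have "c < 101263000"
      by linarith
    then obtain i where "i < 847" "c \<sim> 101263000 + i"
      using enters_window[of 101263000 847 c, OF tau_small] \<open>0 < c\<close> by blast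
    moreover have "101263000 + i \<sim> 101263000 + 1394"
      by (rule window_merges_sound[OF window_at_101263000 _ _ _ _ _ _ \<open>i < 847\<close>]) simp_all
    ultimately show ?thesis
      using coalesce_trans by blast
  qed
  then show ?thesis
    using assms coalesce_trans coalesce_sym by blast
qed

end
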